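(* The logic $\text{Ł}_{\mathrm{Chang}}$ is not strongly complete with respect to $\mathcal V$.
   Context: **BL-algebras.** A BL-algebra is $\mathcal A=\langle A,*,\Rightarrow,\sqcap,\sqcup,0,1\rangle$ such that $\langle A,\sqcap,\sqcup,0,1\rangle$ is a bounded lattice, $\langle A,*,1\rangle$ is a commutative monoid, $z*x\le y$ iff $z\le x\Rightarrow y$, and $(x\Rightarrow y)\sqcup(y\Rightarrow x)=1$, $x\sqcap y=x*(x\Rightarrow y)$. **Logic.** Formulas are built from a denumerable set $VAR$ of variables with $\&,\to,\bot$. Derived connectives: $\neg\varphi=\varphi\to\bot$, $\varphi\leftrightarrow\psi=(\varphi\to\psi)\&(\psi\to\varphi)$, $\varphi^2=\varphi\&\varphi$, $2\varphi=\neg(\neg\varphi\&\neg\varphi)$. BL has modus ponens as only rule and axioms: $(\varphi\to\psi)\to((\psi\to\chi)\to(\varphi\to\chi))$; $(\varphi\&\psi)\to\varphi$; $(\varphi\&\psi)\to(\psi\&\varphi)$; $(\varphi\&(\varphi\to\psi))\to(\psi\&(\psi\to\varphi))$; $(\varphi\to(\psi\to\chi))\to((\varphi\&\psi)\to\chi)$; $((\varphi\&\psi)\to\chi)\to(\varphi\to(\psi\to\chi))$; $((\varphi\to\psi)\to\chi)\to(((\psi\to\varphi)\to\chi)\to\chi)$; $\bot\to\varphi$. Łukasiewicz logic Ł is BL plus $\neg\neg\varphi\to\varphi$. $\text{Ł}_{\mathrm{Chang}}$ is Ł plus the axiom schema $(2\varphi)^2\leftrightarrow2(\varphi^2)$.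 $T\vdash_L\varphi$ denotes derivability of $\varphi$ from a set of formulas $T$ in $L$. **Semantics.** An $\mathcal A$-evaluation $v$ maps $VAR$ to $A$ and is extended to formulas by interpreting $\&,\to,\bot$ as $*,\Rightarrow,0$. $T\models_{\mathcal A}\varphi$ means: every $\mathcal A$-evaluation $v$ with $v(\psi)=1$ for all $\psi\in T$ satisfies $v(\varphi)=1$. $L$ is strongly complete with respect to $\mathcal A$ if for every (possibly infinite) set $T$ of formulas and every formula $\varphi$: $T\vdash_L\varphi$ iff $T\models_{\mathcal A}\varphi$. **Hoops.** A hoop is $\langle A,*,\Rightarrow,1\rangle$ with $\langle A,*,1\rangle$ a commutative monoid and $x\Rightarrow x=1$, $x\Rightarrow(y\Rightarrow z)=(x*y)\Rightarrow z$, $x*(x\Rightarrow y)=y*(y\Rightarrow x)$; its order is $x\le y$ iff $x\Rightarrow y=1$. It is cancellative if $x=y\Rightarrow(x*y)$ holds. The standard cancellative hoop $(0,1]_C$ is $(0,1]$ with ordinary product and $x\Rightarrow y=\min(1,y/x)$. **Disconnected rotation.** For a cancellative hoop $\mathcal A$, let $A'=\{a':a\in A\}$ be a disjoint copy of $A$ with the inverse order, and $A^*=A\cup A'$ with $a'<b$ for all $a,b\in A$. Put $1=1_{\mathcal A}$, $0=1'$, $\sim a=a'$ and $\sim a'=a$ for $a\in A$; lattice operations come from the order. The product $a*b$ is: $a*_{\mathcal A}b$ if $a,b\in A$; $\sim(a\Rightarrow_{\mathcal A}\sim b)$ if $a\in A,b\in A'$; $\sim(b\Rightarrow_{\mathcal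 A}\sim a)$ if $a\in A',b\in A$; $0$ if $a,b\in A'$. The implication $a\Rightarrow b$ is: $a\Rightarrow_{\mathcal A}b$ if $a,b\in A$; $\sim(a*_{\mathcal A}\sim b)$ if $a\in A,b\in A'$; $1$ if $a\in A',b\in A$; $(\sim b)\Rightarrow_{\mathcal A}(\sim a)$ if $a,b\in A'$. The result $\mathcal A^*$ is the disconnected rotation of $\mathcal A$. Let $\mathcal V=((0,1]_C)^*$. *)

theory Defs
  imports Complex_Main
begin

section \<open>Hoops and BL-algebras\<close>

record 'a hoop =
  hcarrier :: "'a set"
  hmult :: "'a \<Rightarrow> 'a \<Rightarrow> 'a"
  himp :: "'a \<Rightarrow> 'a \<Rightarrow> 'a"
  hone :: 'a

record 'a bl_algebra = "'a hoop" +
  bmeet :: "'a \<Rightarrow> 'a \<Rightarrow> 'a"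
  bjoin :: "'a \<Rightarrow> 'a \<Rightarrow> 'a"
  bzero :: 'a

definition comm_monoid_on :: "'a set \<Rightarrow> ('a \<Rightarrow> 'a \<Rightarrow> 'a) \<Rightarrow> 'a \<Rightarrow> bool" where
  "comm_monoid_on A m e \<longleftrightarrow>
     e \<in> A \<and> (\<forall>x\<in>A. \<forall>y\<in>A. m x y \<in> A) \<and>
     (\<forall>x\<in>A. \<forall>y\<in>A. \<forall>z\<in>A. m (m x y) z = m x (m y z)) \<and>
     (\<forall>x\<in>A. \<forall>y\<in>A. m x y = m y x) \<and>
     (\<forall>x\<in>A. m e x = x)"

definition is_hoop :: "('a, 'm) hoop_scheme \<Rightarrow> bool" where
  "is_hoop H \<longleftrightarrow>
     comm_monoid_on (hcarrier H) (hmult H) (hone H) \<and>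
     (\<forall>x\<in>hcarrier H. \<forall>y\<in>hcarrier H. himp H x y \<in> hcarrier H) \<and>
     (\<forall>x\<in>hcarrier H. himp H x x = hone H) \<and>
     (\<forall>x\<in>hcarrier H. \<forall>y\<in>hcarrier H. \<forall>z\<in>hcarrier H.
        himp H x (himp H y z) = himp H (hmult H x y) z) \<and>
     (\<forall>x\<in>hcarrier H. \<forall>y\<in>hcarrier H.
        hmult H x (himp H x y) = hmult H y (himp H y x))"

definition cancellative_hoop :: "('a, 'm) hoop_scheme \<Rightarrow> bool" where
  "cancellative_hoop H \<longleftrightarrow> is_hoop H \<and>
     (\<forall>x\<in>hcarrier H. \<forall>y\<in>hcarrier H. x = himp H y (hmult H x y))"

definition hoop_le :: "('a, 'm) hoop_scheme \<Rightarrow> 'a \<Rightarrow> 'a \<Rightarrow> bool" where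
  "hoop_le H x y \<longleftrightarrow> himp H x y = hone H"

definition bounded_lattice_on ::
    "'a set \<Rightarrow> ('a \<Rightarrow> 'a \<Rightarrow> 'a) \<Rightarrow> ('a \<Rightarrow> 'a \<Rightarrow> 'a) \<Rightarrow> 'a \<Rightarrow> 'a \<Rightarrow> bool" where
  "bounded_lattice_on A meet join z e \<longleftrightarrow>
     z \<in> A \<and> e \<in> A \<and>
     (\<forall>x\<in>A. \<forall>y\<in>A. meet x y \<in> A \<and> join x y \<in> A) \<and>
     (\<forall>x\<in>A. \<forall>y\<in>A. meet x y = meet y x \<and> join x y = join y x) \<and>
     (\<forall>x\<in>A. \<forall>y\<in>A. \<forall>w\<in>A. meet (meet x y) w = meet x (meet y w) \<and>
        join (join x y) w = join x (join y w)) \<and>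
     (\<forall>x\<in>A. \<forall>y\<in>A. meet x (join x y) = x \<and> join x (meet x y) = x) \<and>
     (\<forall>x\<in>A. meet z x = z \<and> join e x = e)"

text \<open>The order used in the residuation condition is that of the lattice reduct.\<close>

definition is_bl_algebra :: "('a, 'm) bl_algebra_scheme \<Rightarrow> bool" where
  "is_bl_algebra B \<longleftrightarrow>
     bounded_lattice_on (hcarrier B) (bmeet B) (bjoin B) (bzero B) (hone B) \<and>
     comm_monoid_on (hcarrier B) (hmult B) (hone B) \<and>
     (\<forall>x\<in>hcarrier B. \<forall>y\<in>hcarrier B. himp B x y \<in> hcarrier B) \<and>
     (\<forall>x\<in>hcarrier B. \<forall>y\<in>hcarrier B. \<forall>z\<in>hcarrier B.
        bmeet B (hmult B z x) y = hmult B z x \<longleftrightarrow> bmeet B z (himp B x y) = z) \<and>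
     (\<forall>x\<in>hcarrier B. \<forall>y\<in>hcarrier B. bjoin B (himp B x y) (himp B y x) = hone B) \<and>
     (\<forall>x\<in>hcarrier B. \<forall>y\<in>hcarrier B. bmeet B x y = hmult B x (himp B x y))"


section \<open>Disconnected rotation\<close>

text \<open>\<open>Pos a\<close> is the element \<open>a\<close> of the hoop, \<open>Neg a\<close> its primed copy.\<close>

datatype 'a rot = Pos 'a | Neg 'a

fun rot_neg :: "'a rot \<Rightarrow> 'a rot" where
  "rot_neg (Pos a) = Neg a"
| "rot_neg (Neg a) = Pos a"

fun rot_le :: "('a, 'm) hoop_scheme \<Rightarrow> 'a rot \<Rightarrow> 'a rot \<Rightarrow> bool" where
  "rot_le H (Pos a) (Pos b) = hoop_le H a b"
| "rot_le H (Pos a) (Neg b) = False"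
| "rot_le H (Neg a) (Pos b) = True"
| "rot_le H (Neg a) (Neg b) = hoop_le H b a"

fun rot_mult :: "('a, 'm) hoop_scheme \<Rightarrow> 'a rot \<Rightarrow> 'a rot \<Rightarrow> 'a rot" where
  "rot_mult H (Pos a) (Pos b) = Pos (hmult H a b)"
| "rot_mult H (Pos a) (Neg b) = rot_neg (Pos (himp H a b))"
| "rot_mult H (Neg a) (Pos b) = rot_neg (Pos (himp H b a))"
| "rot_mult H (Neg a) (Neg b) = Neg (hone H)"

fun rot_imp :: "('a, 'm) hoop_scheme \<Rightarrow> 'a rot \<Rightarrow> 'a rot \<Rightarrow> 'a rot" where
  "rot_imp H (Pos a) (Pos b) = Pos (himp H a b)"
| "rot_imp H (Pos a) (Neg b) = rot_neg (Pos (hmult H a b))"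
| "rot_imp H (Neg a) (Pos b) = Pos (hone H)"
| "rot_imp H (Neg a) (Neg b) = Pos (himp H b a)"

definition rot_carrier :: "('a, 'm) hoop_scheme \<Rightarrow> 'a rot set" where
  "rot_carrier H = Pos ` hcarrier H \<union> Neg ` hcarrier H"

definition rot_meet :: "('a, 'm) hoop_scheme \<Rightarrow> 'a rot \<Rightarrow> 'a rot \<Rightarrow> 'a rot" where
  "rot_meet H x y = (THE z. z \<in> rot_carrier H \<and> rot_le H z x \<and> rot_le H z y \<and>
     (\<forall>w\<in>rot_carrier H. rot_le H w x \<and> rot_le H w y \<longrightarrow> rot_le H w z))"

definition rot_join :: "('a, 'm) hoop_scheme \<Rightarrow> 'a rot \<Rightarrow> 'a rot \<Rightarrow> 'a rot" where
  "rot_join H x y = (THE z. z \<in> rot_carrier H \<and> rot_le H x z \<and> rot_le H y z \<and>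
     (\<forall>w\<in>rot_carrier H. rot_le H x w \<and> rot_le H y w \<longrightarrow> rot_le H z w))"

definition disconnected_rotation :: "('a, 'm) hoop_scheme \<Rightarrow> 'a rot bl_algebra" where
  "disconnected_rotation H =
     \<lparr> hcarrier = rot_carrier H, hmult = rot_mult H, himp = rot_imp H, hone = Pos (hone H),
       bmeet = rot_meet H, bjoin = rot_join H, bzero = Neg (hone H) \<rparr>"

definition standard_cancellative_hoop :: "real hoop" where
  "standard_cancellative_hoop =
     \<lparr> hcarrier = {0<..1}, hmult = (\<lambda>x y. x * y), himp = (\<lambda>x y. min 1 (y / x)), hone = 1 \<rparr>"

definition V_algebra :: "real rot bl_algebra" where
  "V_algebra = disconnected_rotation standard_cancellative_hoop"

context
begin

private abbreviation (input) "H \<equiv> standard_cancellative_hoop"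

private lemma H_simps:
  "hcarrier H = {0<..1}" "hmult H a b = a * b" "himp H a b = min 1 (b / a)" "hone H = 1"
  by (simp_all add: standard_cancellative_hoop_def)

private lemma prod_le: "a * b \<le> a \<and> a * b \<le> b" if "0 < a" "a \<le> 1" "0 < b" "b \<le> 1" for a b :: real
  using that by (simp add: mult_left_le mult_left_le_one_le)

lemma standard_cancellative_hoop: "cancellative_hoop standard_cancellative_hoop"
proof -
  have "min 1 (min 1 (z / y) / x) = min 1 (z / (x * y))"
    if "0 < x" "x \<le> 1" "0 < y" "y \<le> 1" "0 < z" "z \<le> 1" for x y z :: real
    using that by (auto simp: min_def field_simps; use prod_le[OF that(1-4)] in linarith)
  moreover have "x * min 1 (y / x) = y * min 1 (x / y)" if "0 < x" "0 < y" for x y :: real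
    using that by (auto simp: min_def field_simps)
  ultimately show ?thesis
    by (auto simp: cancellative_hoop_def is_hoop_def comm_monoid_on_def H_simps mult_le_one)
qed

text \<open>The carrier of the rotated hoop embeds into the reals as an ordered set.\<close>

private fun emb :: "real rot \<Rightarrow> real" where
  "emb (Pos a) = a"
| "emb (Neg a) = - a"

private abbreviation (input) "C \<equiv> rot_carrier H"

private lemma C_iff: "Pos a \<in> C \<longleftrightarrow> 0 < a \<and> a \<le> 1" "Neg a \<in> C \<longleftrightarrow> 0 < a \<and> a \<le> 1"
  by (auto simp: rot_carrier_def H_simps)

private lemma le_emb:
  assumes "x \<in> C" "y \<in> C" shows "rot_le H x y \<longleftrightarrow> emb x \<le> emb y"
proof -
  have "hoop_le H a b \<longleftrightarrow> a \<le> b" if "0 < a" for a b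
    using that by (simp add: hoop_le_def H_simps min_def field_simps)
  then show ?thesis using assms by (cases x; cases y) (auto simp: C_iff)
qed

private lemma emb_inj: "x \<in> C \<Longrightarrow> y \<in> C \<Longrightarrow> emb x = emb y \<longleftrightarrow> x = y"
  by (cases x; cases y) (auto simp: C_iff)

private lemma meet_eq:
  assumes "x \<in> C" "y \<in> C" shows "rot_meet H x y = (if emb x \<le> emb y then x else y)"
  unfolding rot_meet_def
proof (rule the_equality)
  fix z assume z: "z \<in> C \<and> rot_le H z x \<and> rot_le H z y \<and>
     (\<forall>w\<in>C. rot_le H w x \<and> rot_le H w y \<longrightarrow> rot_le H w z)"
  then have "emb z = min (emb x) (emb y)"
    using assms le_emb by (smt (verit))
  then show "z = (if emb x \<le> emb y then x else y)"
    using z assms emb_inj by (auto simp: min_def split: if_splits)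
qed (use assms in \<open>auto simp: le_emb\<close>)

private lemma join_eq:
  assumes "x \<in> C" "y \<in> C" shows "rot_join H x y = (if emb x \<le> emb y then y else x)"
  unfolding rot_join_def
proof (rule the_equality)
  fix z assume z: "z \<in> C \<and> rot_le H x z \<and> rot_le H y z \<and>
     (\<forall>w\<in>C. rot_le H x w \<and> rot_le H y w \<longrightarrow> rot_le H z w)"
  then have "emb z = max (emb x) (emb y)"
    using assms le_emb by (smt (verit))
  then show "z = (if emb x \<le> emb y then y else x)"
    using z assms emb_inj by (auto simp: max_def split: if_splits)
qed (use assms in \<open>auto simp: le_emb\<close>)

private lemma mult_C: "x \<in> C \<Longrightarrow> y \<in> C \<Longrightarrow> rot_mult H x y \<in> C"
  by (cases x; cases y) (auto simp: C_iff H_simps mult_le_one)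

private lemma imp_C: "x \<in> C \<Longrightarrow> y \<in> C \<Longrightarrow> rot_imp H x y \<in> C"
  by (cases x; cases y) (auto simp: C_iff H_simps mult_le_one)

private lemma mult_comm: "rot_mult H x y = rot_mult H y x"
  by (cases x; cases y) (auto simp: H_simps)

private lemma imp_div:
  assumes "0 < x" "x \<le> 1" "0 < y" "y \<le> (1::real)"
  shows "min 1 (min 1 (z / y) / x) = min 1 (z / (x * y))"
    "min 1 (min 1 (z / x) / y) = min 1 (z / (x * y))"
  using assms by (auto simp: min_def field_simps; use prod_le[OF assms] in linarith)+

private lemma mult_assoc:
  assumes "x \<in> C" "y \<in> C" "z \<in> C"
  shows "rot_mult H (rot_mult H x y) z = rot_mult H x (rot_mult H y z)"
  using assms imp_div
  by (cases x; cases y; cases z) (auto simp: C_iff H_simps mult.commute min_def field_simps)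

private lemma residuation:
  assumes "x \<in> C" "y \<in> C" "z \<in> C"
  shows "emb (rot_mult H z x) \<le> emb y \<longleftrightarrow> emb z \<le> emb (rot_imp H x y)"
proof -
  obtain a b c where "x = Pos a \<or> x = Neg a" "y = Pos b \<or> y = Neg b" "z = Pos c \<or> z = Neg c"
    by (meson rot.exhaust)
  moreover from this assms have bounds: "0 < a" "a \<le> 1" "0 < b" "b \<le> 1" "0 < c" "c \<le> 1"
    by (auto simp: C_iff)
  moreover from bounds have pos: "0 < a * b" "0 < a * c" "0 < b * c" by simp_all
  ultimately show ?thesis
    by (elim disjE; auto simp: H_simps min_def field_simps;
        use bounds pos prod_le[OF bounds(1-4)] prod_le[OF bounds(1,2,5,6)] prod_le[OF bounds(3-6)] in linarith)
qed

private lemma divisibility: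
  assumes "x \<in> C" "y \<in> C"
  shows "rot_meet H x y = rot_mult H x (rot_imp H x y)"
  using assms
  by (cases x; cases y) (auto simp: meet_eq C_iff H_simps min_def field_simps mult_le_one)

private lemma prelinearity:
  assumes "x \<in> C" "y \<in> C"
  shows "rot_join H (rot_imp H x y) (rot_imp H y x) = Pos 1"
  using assms imp_C[of x y] imp_C[of y x]
  by (cases x; cases y) (auto simp: join_eq C_iff H_simps min_def field_simps,
    (smt (verit) mult_pos_pos)+)

lemma V_algebra_bl: "is_bl_algebra V_algebra"
proof -
  have "bounded_lattice_on C (rot_meet H) (rot_join H) (Neg 1) (Pos 1)"
  proof -
    have low: "emb (Neg 1) \<le> emb x" "emb x \<le> emb (Pos 1)" if "x \<in> C" for x
      using that by (cases x; auto simp: C_iff)+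
    have P: "Pos 1 \<in> C" "Neg 1 \<in> C" by (simp_all add: C_iff)
    have top: "rot_join H (Pos 1) x = Pos 1" if "x \<in> C" for x
      using that low[OF that] P emb_inj by (force simp: join_eq simp del: emb.simps)
    show ?thesis
      unfolding bounded_lattice_on_def using P low top
      by (auto simp: meet_eq join_eq emb_inj[symmetric] simp del: emb.simps)
  qed
  moreover have "comm_monoid_on C (rot_mult H) (Pos 1)"
  proof -
    have "rot_mult H (Pos 1) x = x" if "x \<in> C" for x
      using that by (cases x) (auto simp: C_iff H_simps)
    then show ?thesis
      unfolding comm_monoid_on_def using mult_C mult_assoc mult_comm by (simp add: C_iff)
  qed
  moreover have "rot_meet H (rot_mult H z x) y = rot_mult H z x \<longleftrightarrow>
      rot_meet H z (rot_imp H x y) = z" if "x \<in> C" "y \<in> C" "z \<in> C" for x y z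
    using residuation[OF that] that emb_inj by (auto simp: meet_eq mult_C imp_C)
  ultimately show ?thesis
    using imp_C prelinearity divisibility
    by (simp add: is_bl_algebra_def V_algebra_def disconnected_rotation_def H_simps(4))
qed

end


section \<open>Formulas and logics\<close>

text \<open>The denumerable set of variables is the set of natural numbers.\<close>

datatype fm =
    Var nat
  | Bot (\<open>\<^bold>\<bottom>\<close>)
  | Conj fm fm (infixr \<open>\<^bold>&\<close> 70)
  | Imp fm fm (infixr \<open>\<^bold>\<rightarrow>\<close> 60)

definition Neg_fm :: "fm \<Rightarrow> fm" (\<open>\<^bold>\<not> _\<close> [80] 80) where
  "\<^bold>\<not> \<phi> = (\<phi> \<^bold>\<rightarrow> \<^bold>\<bottom>)"

definition Iff :: "fm \<Rightarrow> fm \<Rightarrow> fm" (infix \<open>\<^bold>\<leftrightarrow>\<close> 55) where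
  "\<phi> \<^bold>\<leftrightarrow> \<psi> = ((\<phi> \<^bold>\<rightarrow> \<psi>) \<^bold>& (\<psi> \<^bold>\<rightarrow> \<phi>))"

definition square :: "fm \<Rightarrow> fm" where
  "square \<phi> = \<phi> \<^bold>& \<phi>"

definition double :: "fm \<Rightarrow> fm" where
  "double \<phi> = \<^bold>\<not> (\<^bold>\<not> \<phi> \<^bold>& \<^bold>\<not> \<phi>)"

inductive_set BL_axioms :: "fm set" where
  "(\<phi> \<^bold>\<rightarrow> \<psi>) \<^bold>\<rightarrow> ((\<psi> \<^bold>\<rightarrow> \<chi>) \<^bold>\<rightarrow> (\<phi> \<^bold>\<rightarrow> \<chi>)) \<in> BL_axioms"
| "(\<phi> \<^bold>& \<psi>) \<^bold>\<rightarrow> \<phi> \<in> BL_axioms"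
| "(\<phi> \<^bold>& \<psi>) \<^bold>\<rightarrow> (\<psi> \<^bold>& \<phi>) \<in> BL_axioms"
| "(\<phi> \<^bold>& (\<phi> \<^bold>\<rightarrow> \<psi>)) \<^bold>\<rightarrow> (\<psi> \<^bold>& (\<psi> \<^bold>\<rightarrow> \<phi>)) \<in> BL_axioms"
| "(\<phi> \<^bold>\<rightarrow> (\<psi> \<^bold>\<rightarrow> \<chi>)) \<^bold>\<rightarrow> ((\<phi> \<^bold>& \<psi>) \<^bold>\<rightarrow> \<chi>) \<in> BL_axioms"
| "((\<phi> \<^bold>& \<psi>) \<^bold>\<rightarrow> \<chi>) \<^bold>\<rightarrow> (\<phi> \<^bold>\<rightarrow> (\<psi> \<^bold>\<rightarrow> \<chi>)) \<in> BL_axioms"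
| "((\<phi> \<^bold>\<rightarrow> \<psi>) \<^bold>\<rightarrow> \<chi>) \<^bold>\<rightarrow> (((\<psi> \<^bold>\<rightarrow> \<phi>) \<^bold>\<rightarrow> \<chi>) \<^bold>\<rightarrow> \<chi>) \<in> BL_axioms"
| "\<^bold>\<bottom> \<^bold>\<rightarrow> \<phi> \<in> BL_axioms"

definition Lukasiewicz_axioms :: "fm set" where
  "Lukasiewicz_axioms = BL_axioms \<union> {\<^bold>\<not> \<^bold>\<not> \<phi> \<^bold>\<rightarrow> \<phi> | \<phi>. True}"

definition L_Chang_axioms :: "fm set" where
  "L_Chang_axioms = Lukasiewicz_axioms \<union>
     {square (double \<phi>) \<^bold>\<leftrightarrow> double (square \<phi>) | \<phi>. True}"

text \<open>A logic is given by its set of axioms; modus ponens is the only rule.\<close>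

inductive derivable :: "fm set \<Rightarrow> fm set \<Rightarrow> fm \<Rightarrow> bool" for L T where
  axiom: "\<phi> \<in> L \<Longrightarrow> derivable L T \<phi>"
| hyp: "\<phi> \<in> T \<Longrightarrow> derivable L T \<phi>"
| mp: "derivable L T \<phi> \<Longrightarrow> derivable L T (\<phi> \<^bold>\<rightarrow> \<psi>) \<Longrightarrow> derivable L T \<psi>"


section \<open>Semantics\<close>

primrec fm_value :: "('a, 'm) bl_algebra_scheme \<Rightarrow> (nat \<Rightarrow> 'a) \<Rightarrow> fm \<Rightarrow> 'a" where
  "fm_value A v (Var n) = v n"
| "fm_value A v \<^bold>\<bottom> = bzero A"
| "fm_value A v (\<phi> \<^bold>& \<psi>) = hmult A (fm_value A v \<phi>) (fm_value A v \<psi>)"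
| "fm_value A v (\<phi> \<^bold>\<rightarrow> \<psi>) = himp A (fm_value A v \<phi>) (fm_value A v \<psi>)"

definition entails :: "('a, 'm) bl_algebra_scheme \<Rightarrow> fm set \<Rightarrow> fm \<Rightarrow> bool" where
  "entails A T \<phi> \<longleftrightarrow>
     (\<forall>v. (\<forall>n. v n \<in> hcarrier A) \<longrightarrow> (\<forall>\<psi>\<in>T. fm_value A v \<psi> = hone A) \<longrightarrow>
        fm_value A v \<phi> = hone A)"

definition strongly_complete :: "fm set \<Rightarrow> ('a, 'm) bl_algebra_scheme \<Rightarrow> bool" where
  "strongly_complete L A \<longleftrightarrow> (\<forall>T \<phi>. derivable L T \<phi> \<longleftrightarrow> entails A T \<phi>)"

end

theory Submission
  imports Defs
begin

text \<open>
  Derivability is finitary: a derivation uses finitely many hypotheses. Semantic consequence over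
  \<open>V_algebra\<close> is not, because the positive part of \<open>V_algebra\<close> is the Archimedean hoop \<open>(0,1]\<close>.
  There an element \<open>a\<close> is \<open>1\<close> as soon as a single \<open>b > 0\<close> lies below all powers of \<open>a\<close>. The
  premises \<open>q \<rightarrow> p\<^sup>n\<close> for all \<open>n \<ge> 1\<close>, together with a formula that puts \<open>q\<close> into the positive part,
  therefore entail \<open>p\<close>; but finitely many of them do not, as \<open>p = 1/2\<close> and \<open>q = (1/2)\<^sup>N\<close> show
  for large \<open>N\<close>.

  Strong completeness would make the two consequence relations equal, so compactness of the first
  (\<open>derivable_compact\<close>) would carry over to the second.
\<close>

lemma derivable_mono:
  assumes "derivable L S \<phi>" and "S \<subseteq> T"
  shows "derivable L T \<phi>"
  using assms by (induction rule: derivable.induct) (auto intro: derivable.intros)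

text \<open>Modus ponens is the only rule and has finitely many premises.\<close>

lemma derivable_compact:
  assumes "derivable L T \<phi>"
  shows "\<exists>S. finite S \<and> S \<subseteq> T \<and> derivable L S \<phi>"
  using assms
proof (induction rule: derivable.induct)
  case (axiom \<phi>)
  then show ?case by (blast intro: derivable.axiom)
next
  case (hyp \<phi>)
  then have "finite {\<phi>}" "{\<phi>} \<subseteq> T" "derivable L {\<phi>} \<phi>" by (auto intro: derivable.hyp)
  then show ?case by blast
next
  case (mp \<phi> \<psi>)
  then obtain S S' where "finite S" "S \<subseteq> T" "derivable L S \<phi>"
    and "finite S'" "S' \<subseteq> T" "derivable L S' (\<phi> \<^bold>\<rightarrow> \<psi>)" by blast
  then have "finite (S \<union> S')" "S \<union> S' \<subseteq> T" "derivable L (S \<union> S') \<psi>"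
    by (auto intro: derivable.mp derivable_mono)
  then show ?case by blast
qed

lemma V_algebra_simps:
  "Pos a \<in> hcarrier V_algebra \<longleftrightarrow> 0 < a \<and> a \<le> 1"
  "Neg a \<in> hcarrier V_algebra \<longleftrightarrow> 0 < a \<and> a \<le> 1"
  "hone V_algebra = Pos 1"
  "bzero V_algebra = Neg 1"
  "hmult V_algebra (Pos a) (Pos b) = Pos (a * b)"
  "hmult V_algebra (Neg a) (Neg b) = Neg 1"
  "himp V_algebra (Pos a) (Pos b) = Pos (min 1 (b / a))"
  "himp V_algebra (Pos a) (Neg b) = Neg (a * b)"
  "himp V_algebra (Neg a) (Pos b) = Pos 1"
  "himp V_algebra (Neg a) (Neg b) = Pos (min 1 (a / b))"
  by (auto simp: V_algebra_def disconnected_rotation_def standard_cancellative_hoop_def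
      rot_carrier_def)

primrec pow_Suc :: "fm \<Rightarrow> nat \<Rightarrow> fm" where
  "pow_Suc \<phi> 0 = \<phi>"
| "pow_Suc \<phi> (Suc n) = \<phi> \<^bold>& pow_Suc \<phi> n"

lemma fm_value_pow_Suc:
  assumes "fm_value V_algebra v \<phi> = Pos a"
  shows "fm_value V_algebra v (pow_Suc \<phi> n) = Pos (a ^ Suc n)"
  using assms by (induction n) (simp_all add: V_algebra_simps)

definition power_bound :: "nat \<Rightarrow> fm" where
  "power_bound n = (Var 1 \<^bold>\<rightarrow> pow_Suc (Var 0) n)"

text \<open>
  In the negative part \<open>\<^bold>\<not> q\<close> lies strictly above \<open>q\<close>, so the first premise says exactly that the
  value of \<open>q\<close>, the variable with index 1, is positive. Without it, a negative \<open>q\<close> would be below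
  all powers of any positive \<open>p\<close>, the variable with index 0.
\<close>

definition archimedean_premises :: "fm set" where
  "archimedean_premises = insert (\<^bold>\<not> (Var 1) \<^bold>\<rightarrow> Var 1) (range power_bound)"

lemma archimedean_premises_entail: "entails V_algebra archimedean_premises (Var 0)"
  unfolding entails_def
proof (intro allI impI)
  fix v :: "nat \<Rightarrow> real rot"
  assume v: "\<forall>n. v n \<in> hcarrier V_algebra"
    and prem: "\<forall>\<psi>\<in>archimedean_premises. fm_value V_algebra v \<psi> = hone V_algebra"
  have positive: "fm_value V_algebra v (\<^bold>\<not> (Var 1) \<^bold>\<rightarrow> Var 1) = Pos 1"
    and bound: "fm_value V_algebra v (power_bound n) = Pos 1" for n
    using prem by (auto simp: archimedean_premises_def V_algebra_simps)
  obtain b where b: "v 1 = Pos b"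
    using positive by (cases "v 1") (auto simp: Neg_fm_def V_algebra_simps)
  \<comment> \<open>A negative \<open>p\<close> has square \<open>0\<close>, which is not above a positive \<open>q\<close>.\<close>
  obtain a where a: "v 0 = Pos a"
    using bound[of 1] b by (cases "v 0") (auto simp: power_bound_def V_algebra_simps)
  have ab: "0 < a" "a \<le> 1" "0 < b"
    using v a b by (metis V_algebra_simps(1))+
  have le: "b \<le> a ^ Suc n" for n
  proof -
    have "min 1 (a ^ Suc n / b) = 1"
      using bound[of n] a b fm_value_pow_Suc[of v "Var 0" a n]
      by (simp add: power_bound_def V_algebra_simps)
    then show ?thesis using ab by (simp add: min_def field_simps split: if_splits)
  qed
  have "\<not> a < 1"
  proof
    assume "a < 1"
    then obtain n where "a ^ n < b" using real_arch_pow_inv ab by blast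
    moreover have "a ^ Suc n \<le> a ^ n" using ab by (simp add: mult_left_le_one_le)
    ultimately show False using le[of n] by linarith
  qed
  then show "fm_value V_algebra v (Var 0) = hone V_algebra"
    using a ab by (simp add: V_algebra_simps)
qed

lemma finite_archimedean_premises_not_entail:
  assumes "finite S" and "S \<subseteq> archimedean_premises"
  shows "\<not> entails V_algebra S (Var 0)"
proof -
  have "finite (S - {\<^bold>\<not> (Var 1) \<^bold>\<rightarrow> Var 1})" "S - {\<^bold>\<not> (Var 1) \<^bold>\<rightarrow> Var 1} \<subseteq> range power_bound"
    using assms by (auto simp: archimedean_premises_def)
  then obtain I where I: "finite I" "S - {\<^bold>\<not> (Var 1) \<^bold>\<rightarrow> Var 1} = power_bound ` I"
    by (meson finite_subset_image)
  obtain N where N: "\<forall>i\<in>I. i \<le> N" using I(1) finite_nat_set_iff_bounded_le by blast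
  define v :: "nat \<Rightarrow> real rot" where "v i = Pos (if i = 1 then (1/2) ^ Suc N else 1/2)" for i
  have "(1/2::real) ^ Suc N \<le> 1" by (rule power_le_one) auto
  then have carrier: "v i \<in> hcarrier V_algebra" for i
    unfolding v_def V_algebra_simps by simp
  have "fm_value V_algebra v \<psi> = hone V_algebra" if "\<psi> \<in> S" for \<psi>
  proof (cases "\<psi> = \<^bold>\<not> (Var 1) \<^bold>\<rightarrow> Var 1")
    case True
    then show ?thesis by (simp add: v_def Neg_fm_def V_algebra_simps)
  next
    case False
    then have "\<psi> \<in> power_bound ` I" using that I(2) by blast
    then obtain i where i: "i \<le> N" "\<psi> = power_bound i" using N by blast
    have "(1/2::real) ^ Suc N \<le> (1/2) ^ Suc i" using i by (intro power_decreasing) auto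
    then have "min 1 ((1/2::real) ^ Suc i / (1/2) ^ Suc N) = 1"
      by (subst min_absorb1) (simp_all del: power_Suc)
    moreover have "fm_value V_algebra v (pow_Suc (Var 0) i) = Pos ((1/2) ^ Suc i)"
      by (rule fm_value_pow_Suc) (simp add: v_def)
    ultimately show ?thesis
      using i(2) by (simp only: power_bound_def fm_value.simps v_def V_algebra_simps if_True refl)
  qed
  moreover have "fm_value V_algebra v (Var 0) \<noteq> hone V_algebra"
    by (simp add: v_def V_algebra_simps)
  ultimately show ?thesis using carrier unfolding entails_def by blast
qed

theorem theorem3p11:
  shows "\<not> strongly_complete L_Chang_axioms V_algebra"
proof
  assume complete: "strongly_complete L_Chang_axioms V_algebra"
  then have derivable_iff: "derivable L_Chang_axioms T \<phi> \<longleftrightarrow> entails V_algebra T \<phi>" for T \<phi>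
    unfolding strongly_complete_def by simp
  have "derivable L_Chang_axioms archimedean_premises (Var 0)"
    using archimedean_premises_entail by (simp only: derivable_iff)
  from derivable_compact[OF this] obtain S
    where S: "finite S" "S \<subseteq> archimedean_premises" "derivable L_Chang_axioms S (Var 0)"
    by (elim exE conjE)
  from S(3) have "entails V_algebra S (Var 0)" by (simp only: derivable_iff)
  then show False using finite_archimedean_premises_not_entail[OF S(1,2)] by contradiction
qed

end
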